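(* The adjoints of the pre-minimal relation $T_0$ and of the minimal relation $T_{\min}=\overline{T_0}$ both equal the maximal relation: $T_0^*=T_{\min}^*=T_{\max}$.
   Context: Let $n\in\mathbb{N}$, $\mathbb{N}_0=\{0,1,2,\dots\}$ and $\mathcal{J}=\begin{pmatrix}0&I_n\\-I_n&0\end{pmatrix}$. For each $k\in\mathbb{N}_0$ let $S_k,\Psi_k\in\mathbb{C}^{2n\times2n}$ satisfy $S_k^*\mathcal{J}S_k=\mathcal{J}$, $\Psi_k^*=\Psi_k\ge0$ (positive semi-definite) and $\Psi_k\mathcal{J}\Psi_k=0$. For a sequence $z=(z_k)_{k\in\mathbb{N}_0}$ in $\mathbb{C}^{2n}$ put $\mathscr{L}(z)_k=\mathcal{J}(z_k-S_kz_{k+1})$; $\mathscr{L}(z)=\Psi f$ means $\mathscr{L}(z)_k=\Psi_kf_k$ for all $k\in\mathbb{N}_0$. $\langle z,w\rangle_\Psi=\sum_{k=0}^\infty z_k^*\Psi_kw_k$, $\|z\|_\Psi=\langle z,z\rangle_\Psi^{1/2}$, and $\ell^2_\Psi(\mathbb{N}_0)$ is the space of sequences in $\mathbb{C}^{2n}$ with $\|z\|_\Psi<\infty$. $\tilde\ell^2_\Psi(\mathbb{N}_0)$ is the Hilbert space obtained as the quotient of $\ell^2_\Psi(\mathbb{N}_0)$ by $\{z:\|z\|_\Psi=0\}$; classes are denoted $\tilde z$. $\ell^2_{\Psi,0}(\mathbb{N}_0)$ is the set of sequences $z$ in $\mathbb{C}^{2n}$ with only finitely many nonzero terms and with $z_0=0$.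 A linear relation in a Hilbert space $\mathscr{H}$ is a linear subspace $T$ of $\mathscr{H}\times\mathscr{H}$, with elements written $\{z,f\}$; $\overline T$ is its closure, and its adjoint is $T^*=\{\{y,g\}\in\mathscr{H}^2:\langle z,g\rangle=\langle f,y\rangle\ \forall\{z,f\}\in T\}$. In $\mathscr{H}=\tilde\ell^2_\Psi(\mathbb{N}_0)$ define $T_{\max}=\{\{\tilde z,\tilde f\}:\exists\,u\in\tilde z\text{ with }\mathscr{L}(u)=\Psi f\}$, $T_0=\{\{\tilde z,\tilde f\}:\exists\,u\in\tilde z\cap\ell^2_{\Psi,0}(\mathbb{N}_0)\text{ with }\mathscr{L}(u)=\Psi f\}$, $T_{\min}=\overline{T_0}$ ($\Psi f$ does not depend on the representative $f\in\tilde f$). *)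

theory Defs
  imports "HOL-Analysis.Analysis"
begin

section \<open>Matrices\<close>

text \<open>Conjugate transpose, and the product \<open>v\<^sup>* w\<close>, conjugate-linear in the first argument.\<close>

definition ctransp :: "complex^'a^'b \<Rightarrow> complex^'b^'a" where
  "ctransp A = (\<chi> i j. cnj (A $ j $ i))"

definition cdot :: "complex^'a \<Rightarrow> complex^'a \<Rightarrow> complex" where
  "cdot v w = (\<Sum>i\<in>UNIV. cnj (v $ i) * w $ i)"

definition pos_semidef :: "complex^'a^'a \<Rightarrow> bool" where
  "pos_semidef A \<longleftrightarrow> ctransp A = A \<and> (\<forall>v. cdot v (A *v v) \<in> \<real>\<^sub>\<ge>\<^sub>0)"

text \<open>The space \<open>\<complex>\<^sup>2\<^sup>n\<close> is \<open>complex^('n + 'n)\<close> with \<open>n = CARD('n) \<ge> 1\<close>; the summands \<open>Inl\<close> and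
  \<open>Inr\<close> index the first and the last \<open>n\<close> coordinates.\<close>

definition Jmat :: "complex^('n + 'n)^('n::finite + 'n)" where
  "Jmat = (\<chi> a b. case (a, b) of
      (Inl i, Inr j) \<Rightarrow> (if i = j then 1 else 0)
    | (Inr i, Inl j) \<Rightarrow> (if i = j then - 1 else 0)
    | _ \<Rightarrow> 0)"


section \<open>Linear relations in a Hilbert space with carrier \<open>H\<close>\<close>

definition adjoint_rel ::
    "'h set \<Rightarrow> ('h \<Rightarrow> 'h \<Rightarrow> complex) \<Rightarrow> ('h \<times> 'h) set \<Rightarrow> ('h \<times> 'h) set" where
  "adjoint_rel H ip T = {(y, g). y \<in> H \<and> g \<in> H \<and> (\<forall>(z, f)\<in>T. ip z g = ip f y)}"

definition closure_rel ::
    "'h set \<Rightarrow> ('h \<Rightarrow> 'h \<Rightarrow> real) \<Rightarrow> ('h \<times> 'h) set \<Rightarrow> ('h \<times> 'h) set" where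
  "closure_rel H d T =
     prod_topology (Metric_space.mtopology H d) (Metric_space.mtopology H d) closure_of T"


section \<open>The space of square summable sequences and its quotient\<close>

type_synonym 'a cseq = "nat \<Rightarrow> complex^'a"

definition ip_seq :: "(nat \<Rightarrow> complex^'a^'a) \<Rightarrow> 'a cseq \<Rightarrow> 'a cseq \<Rightarrow> complex" where
  "ip_seq \<Psi> z w = (\<Sum>k. cdot (z k) (\<Psi> k *v w k))"

definition norm_seq :: "(nat \<Rightarrow> complex^'a^'a) \<Rightarrow> 'a cseq \<Rightarrow> real" where
  "norm_seq \<Psi> z = sqrt (Re (ip_seq \<Psi> z z))"

definition l2 :: "(nat \<Rightarrow> complex^'a^'a) \<Rightarrow> 'a cseq set" where
  "l2 \<Psi> = {z. summable (\<lambda>k. cdot (z k) (\<Psi> k *v z k))}"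

definition l2_rel :: "(nat \<Rightarrow> complex^'a^'a) \<Rightarrow> ('a cseq \<times> 'a cseq) set" where
  "l2_rel \<Psi> = {(z, w). z \<in> l2 \<Psi> \<and> w \<in> l2 \<Psi> \<and> norm_seq \<Psi> (\<lambda>k. z k - w k) = 0}"

definition L2 :: "(nat \<Rightarrow> complex^'a^'a) \<Rightarrow> 'a cseq set set" where
  "L2 \<Psi> = l2 \<Psi> // l2_rel \<Psi>"

text \<open>The inner product and the norm distance of two classes, computed on representatives.
  That they do not depend on the representatives is shown below. The distance is \<open>0\<close> off the
  carrier because \<open>Metric_space\<close> asks for nonnegativity and symmetry everywhere.\<close>

definition ip_L2 :: "(nat \<Rightarrow> complex^'a^'a) \<Rightarrow> 'a cseq set \<Rightarrow> 'a cseq set \<Rightarrow> complex" where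
  "ip_L2 \<Psi> Z W = (THE c. \<exists>z\<in>Z. \<exists>w\<in>W. c = ip_seq \<Psi> z w)"

definition dist_L2 :: "(nat \<Rightarrow> complex^'a^'a) \<Rightarrow> 'a cseq set \<Rightarrow> 'a cseq set \<Rightarrow> real" where
  "dist_L2 \<Psi> Z W = (if Z \<in> L2 \<Psi> \<and> W \<in> L2 \<Psi>
     then THE r. \<exists>z\<in>Z. \<exists>w\<in>W. r = norm_seq \<Psi> (\<lambda>k. z k - w k) else 0)"


section \<open>The relations of the system\<close>

definition Lop :: "(nat \<Rightarrow> complex^('n + 'n)^('n + 'n)) \<Rightarrow> ('n::finite + 'n) cseq \<Rightarrow> ('n + 'n) cseq" where
  "Lop S z = (\<lambda>k. Jmat *v (z k - S k *v z (Suc k)))"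

definition l2_0 :: "'a::finite cseq set" where
  "l2_0 = {z. finite {k. z k \<noteq> 0} \<and> z 0 = 0}"

definition T_max :: "(nat \<Rightarrow> complex^('n + 'n)^('n + 'n)) \<Rightarrow> (nat \<Rightarrow> complex^('n + 'n)^('n::finite + 'n))
    \<Rightarrow> (('n + 'n) cseq set \<times> ('n + 'n) cseq set) set" where
  "T_max S \<Psi> = {(Z, F). Z \<in> L2 \<Psi> \<and> F \<in> L2 \<Psi> \<and>
     (\<exists>u\<in>Z. \<exists>f\<in>F. \<forall>k. Lop S u k = \<Psi> k *v f k)}"

definition T_0 :: "(nat \<Rightarrow> complex^('n + 'n)^('n + 'n)) \<Rightarrow> (nat \<Rightarrow> complex^('n + 'n)^('n::finite + 'n))
    \<Rightarrow> (('n + 'n) cseq set \<times> ('n + 'n) cseq set) set" where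
  "T_0 S \<Psi> = {(Z, F). Z \<in> L2 \<Psi> \<and> F \<in> L2 \<Psi> \<and>
     (\<exists>u\<in>Z \<inter> l2_0. \<exists>f\<in>F. \<forall>k. Lop S u k = \<Psi> k *v f k)}"

definition T_min :: "(nat \<Rightarrow> complex^('n + 'n)^('n + 'n)) \<Rightarrow> (nat \<Rightarrow> complex^('n + 'n)^('n::finite + 'n))
    \<Rightarrow> (('n + 'n) cseq set \<times> ('n + 'n) cseq set) set" where
  "T_min S \<Psi> = closure_rel (L2 \<Psi>) (dist_L2 \<Psi>) (T_0 S \<Psi>)"


section \<open>The quotient is well defined and a metric space\<close>

lemma cdot_simps:
  "cdot (u + v) w = cdot u w + cdot v w"
  "cdot (u - v) w = cdot u w - cdot v w"
  "cdot u (v + w) = cdot u v + cdot u w"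
  "cdot u (v - w) = cdot u v - cdot u w"
  "cdot (c *s u) v = cnj c * cdot u v"
  "cdot u (c *s v) = c * cdot u v"
  "cdot 0 v = 0" "cdot u 0 = 0"
  by (simp_all add: cdot_def algebra_simps sum.distrib sum_subtractf sum_distrib_left)

lemma cdot_commute: "cdot u v = cnj (cdot v u)"
  by (simp add: cdot_def mult.commute)

lemma cdot_self_eq_0: "cdot v v = 0 \<Longrightarrow> v = 0"
proof -
  assume "cdot v v = 0"
  then have "(\<Sum>i\<in>UNIV. complex_of_real ((cmod (v $ i))\<^sup>2)) = 0"
    unfolding cdot_def complex_norm_square by (simp add: mult.commute)
  then have "(\<Sum>i\<in>UNIV. (cmod (v $ i))\<^sup>2) = 0"
    by (metis of_real_eq_0_iff of_real_sum)
  then have "\<forall>i. cmod (v $ i) = 0"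
    by (simp add: sum_nonneg_eq_0_iff)
  then show "v = 0" by (simp add: vec_eq_iff)
qed

lemma cdot_ctransp: "cdot u (A *v w) = cdot (ctransp A *v u) w"
  unfolding cdot_def ctransp_def matrix_vector_mult_def
  by (simp add: sum_distrib_left sum_distrib_right mult_ac) (rule sum.swap)

lemma herm_cnj: "ctransp A = A \<Longrightarrow> cdot w (A *v v) = cnj (cdot v (A *v w))"
  by (metis cdot_commute cdot_ctransp)

abbreviation qf :: "complex^'a^'a \<Rightarrow> complex^'a \<Rightarrow> real" where
  "qf A v \<equiv> Re (cdot v (A *v v))"

lemma psd_qf:
  assumes "pos_semidef A"
  shows "cdot v (A *v v) = of_real (qf A v)" "qf A v \<ge> 0"
  using assms unfolding pos_semidef_def by (metis Re_complex_of_real nonneg_Reals_cases)+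

lemma psd_CS:
  assumes A: "pos_semidef A"
  shows "(cmod (cdot v (A *v w)))\<^sup>2 \<le> qf A v * qf A w"
proof -
  define b where "b = cdot v (A *v w)"
  have h: "ctransp A = A" using A by (simp add: pos_semidef_def)
  have *: "0 \<le> qf A v - 2 * t * (cmod b)\<^sup>2 + t\<^sup>2 * (cmod b)\<^sup>2 * qf A w" for t :: real
  proof -
    define l where "l = - of_real t * cnj b"
    have "cdot (v + l *s w) (A *v (v + l *s w)) =
        cdot v (A *v v) + l * b + cnj l * cnj b + cnj l * l * cdot w (A *v w)"
      by (simp add: matrix_vector_right_distrib vector_scalar_commute cdot_simps herm_cnj[OF h, of w v]
          b_def algebra_simps)
    also have "l * b = of_real (- t * (cmod b)\<^sup>2)"
      unfolding l_def of_real_mult complex_norm_square by simp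
    also have "cnj l * cnj b = of_real (- t * (cmod b)\<^sup>2)"
      unfolding l_def of_real_mult complex_norm_square by simp
    also have "cnj l * l = of_real (t\<^sup>2 * (cmod b)\<^sup>2)"
      unfolding l_def of_real_mult complex_norm_square by (simp add: power2_eq_square)
    finally have "qf A (v + l *s w) = qf A v - 2 * t * (cmod b)\<^sup>2 + t\<^sup>2 * (cmod b)\<^sup>2 * qf A w"
      by simp
    then show ?thesis using psd_qf(2)[OF A, of "v + l *s w"] by simp
  qed
  show ?thesis
  proof (cases "qf A w = 0")
    case True
    have "b = 0"
    proof (rule ccontr)
      assume "b \<noteq> 0"
      then show False
        using *[of "(qf A v + 1) / (2 * (cmod b)\<^sup>2)"] True by simp
    qed
    then show ?thesis using True by (simp add: b_def)
  next
    case False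
    then have "qf A w > 0" using psd_qf(2)[OF A, of w] by simp
    then show ?thesis
      using *[of "1 / qf A w"] by (simp add: b_def[symmetric] field_simps power2_eq_square)
  qed
qed

lemma psd_kernel:
  assumes "pos_semidef A" "qf A v = 0"
  shows "A *v v = 0"
proof -
  have "(cmod (cdot (A *v v) (A *v v)))\<^sup>2 \<le> 0"
    using psd_CS[OF assms(1), of "A *v v" v] assms(2) by simp
  then show ?thesis by (intro cdot_self_eq_0) simp
qed

lemma qf_triangle:
  assumes A: "pos_semidef A"
  shows "sqrt (qf A (v + w)) \<le> sqrt (qf A v) + sqrt (qf A w)"
proof -
  have h: "ctransp A = A" using A by (simp add: pos_semidef_def)
  have "qf A (v + w) = qf A v + qf A w + 2 * Re (cdot v (A *v w))"
    by (simp add: matrix_vector_right_distrib cdot_simps herm_cnj[OF h, of w v])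
  also have "Re (cdot v (A *v w)) \<le> sqrt (qf A v * qf A w)"
    using psd_CS[OF A, of v w] by (meson complex_Re_le_cmod order_trans real_le_rsqrt)
  finally have "qf A (v + w) \<le> (sqrt (qf A v) + sqrt (qf A w))\<^sup>2"
    using psd_qf(2)[OF A] by (simp add: power2_sum real_sqrt_mult)
  then show ?thesis
    by (meson A add_nonneg_nonneg psd_qf(2) real_le_lsqrt real_sqrt_ge_zero)
qed

context
  fixes \<Psi> :: "nat \<Rightarrow> complex^'a^'a"
  assumes psd: "\<And>k. pos_semidef (\<Psi> k)"
begin

lemma l2_iff: "z \<in> l2 \<Psi> \<longleftrightarrow> summable (\<lambda>k. qf (\<Psi> k) (z k))"
  unfolding l2_def mem_Collect_eq by (subst psd_qf(1)[OF psd]) (simp only: summable_of_real_iff)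

lemma norm_seq_eq: "z \<in> l2 \<Psi> \<Longrightarrow> norm_seq \<Psi> z = sqrt (\<Sum>k. qf (\<Psi> k) (z k))"
  unfolding norm_seq_def ip_seq_def l2_def by (simp add: Re_suminf)

lemma norm_seq_add:
  assumes "z \<in> l2 \<Psi>" "w \<in> l2 \<Psi>"
  shows "(\<lambda>k. z k + w k) \<in> l2 \<Psi>"
    "norm_seq \<Psi> (\<lambda>k. z k + w k) \<le> norm_seq \<Psi> z + norm_seq \<Psi> w"
proof -
  let ?q = "\<lambda>z k. qf (\<Psi> k) (z k)"
  have s: "summable (?q z)" "summable (?q w)" using assms by (simp_all add: l2_iff)
  have nn: "0 \<le> qf (\<Psi> k) v" for k v using psd_qf(2)[OF psd] .
  have part: "sum (?q (\<lambda>k. z k + w k)) {..<n} \<le> (norm_seq \<Psi> z + norm_seq \<Psi> w)\<^sup>2" for n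
  proof -
    have "sqrt (sum (?q (\<lambda>k. z k + w k)) {..<n}) = L2_set (\<lambda>k. sqrt (?q (\<lambda>k. z k + w k) k)) {..<n}"
      by (simp add: L2_set_def nn)
    also have "\<dots> \<le> L2_set (\<lambda>k. sqrt (?q z k) + sqrt (?q w k)) {..<n}"
      by (rule L2_set_mono) (simp_all add: qf_triangle[OF psd] nn)
    also have "\<dots> \<le> L2_set (\<lambda>k. sqrt (?q z k)) {..<n} + L2_set (\<lambda>k. sqrt (?q w k)) {..<n}"
      by (rule L2_set_triangle_ineq)
    also have "\<dots> \<le> norm_seq \<Psi> z + norm_seq \<Psi> w"
      unfolding norm_seq_eq[OF assms(1)] norm_seq_eq[OF assms(2)]
      by (intro add_mono) (simp_all add: L2_set_def nn sum_le_suminf[OF s(1)] sum_le_suminf[OF s(2)])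
    finally show ?thesis by (rule sqrt_le_D)
  qed
  have sum: "summable (?q (\<lambda>k. z k + w k))"
    by (rule summableI_nonneg_bounded[OF nn part])
  then show l: "(\<lambda>k. z k + w k) \<in> l2 \<Psi>" by (simp add: l2_iff)
  have "suminf (?q (\<lambda>k. z k + w k)) \<le> (norm_seq \<Psi> z + norm_seq \<Psi> w)\<^sup>2"
    using sum part by (rule suminf_le_const)
  moreover have "0 \<le> norm_seq \<Psi> z + norm_seq \<Psi> w"
    unfolding norm_seq_eq[OF assms(1)] norm_seq_eq[OF assms(2)]
    by (simp add: nn suminf_nonneg s)
  ultimately show "norm_seq \<Psi> (\<lambda>k. z k + w k) \<le> norm_seq \<Psi> z + norm_seq \<Psi> w"
    unfolding norm_seq_eq[OF l] by (rule real_le_lsqrt[rotated])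
qed

lemma qf_uminus: "qf A (- v) = qf A v"
proof -
  have "A *v (- v) = - (A *v v)"
    by (metis diff_0 matrix_vector_mult_0_right matrix_vector_mult_diff_distrib)
  then show ?thesis by (simp add: cdot_def)
qed

lemma norm_seq_uminus: "(\<lambda>k. - z k) \<in> l2 \<Psi> \<longleftrightarrow> z \<in> l2 \<Psi>"
    "z \<in> l2 \<Psi> \<Longrightarrow> norm_seq \<Psi> (\<lambda>k. - z k) = norm_seq \<Psi> z"
  by (simp_all add: l2_iff norm_seq_eq qf_uminus)

lemma l2_diff: "z \<in> l2 \<Psi> \<Longrightarrow> w \<in> l2 \<Psi> \<Longrightarrow> (\<lambda>k. z k - w k) \<in> l2 \<Psi>"
  using norm_seq_add(1)[of z "\<lambda>k. - w k"] by (simp add: norm_seq_uminus)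

lemma norm_seq_eq_0: "z \<in> l2 \<Psi> \<Longrightarrow> norm_seq \<Psi> z = 0 \<longleftrightarrow> (\<forall>k. \<Psi> k *v z k = 0)"
proof
  assume z: "z \<in> l2 \<Psi>" and "norm_seq \<Psi> z = 0"
  then have "\<forall>k. qf (\<Psi> k) (z k) = 0"
    by (simp add: norm_seq_eq suminf_eq_zero_iff l2_iff psd_qf(2)[OF psd])
  then show "\<forall>k. \<Psi> k *v z k = 0" by (intro allI psd_kernel[OF psd]) simp
qed (simp add: norm_seq_eq cdot_simps(8))

lemma l2_rel_iff:
  "(z, w) \<in> l2_rel \<Psi> \<longleftrightarrow> z \<in> l2 \<Psi> \<and> w \<in> l2 \<Psi> \<and> (\<forall>k. \<Psi> k *v z k = \<Psi> k *v w k)"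
  unfolding l2_rel_def using norm_seq_eq_0[OF l2_diff, of z w]
  by (auto simp: matrix_vector_mult_diff_distrib)

lemma equiv_l2_rel: "equiv (l2 \<Psi>) (l2_rel \<Psi>)"
  by (rule equivI) (auto simp: refl_on_def sym_def trans_def l2_rel_iff)

lemma ip_seq_cong:
  assumes "(z, z') \<in> l2_rel \<Psi>" "(w, w') \<in> l2_rel \<Psi>"
  shows "ip_seq \<Psi> z w = ip_seq \<Psi> z' w'"
proof -
  have "cdot (z k) (\<Psi> k *v w k) = cdot (z' k) (\<Psi> k *v w' k)" for k
  proof -
    have h: "ctransp (\<Psi> k) = \<Psi> k" using psd by (simp add: pos_semidef_def)
    show ?thesis using assms cdot_ctransp[of _ "\<Psi> k"] by (simp add: l2_rel_iff h)
  qed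
  then show ?thesis by (simp add: ip_seq_def)
qed

lemma L2_elems:
  assumes "Z \<in> L2 \<Psi>"
  shows "z \<in> Z \<Longrightarrow> z \<in> l2 \<Psi>" "z \<in> Z \<Longrightarrow> z' \<in> Z \<Longrightarrow> (z, z') \<in> l2_rel \<Psi>" "\<exists>z. z \<in> Z"
proof -
  note Z = assms[unfolded L2_def]
  show "z \<in> Z \<Longrightarrow> z \<in> l2 \<Psi>" using in_quotient_imp_subset[OF equiv_l2_rel Z] by (rule subsetD)
  show "z \<in> Z \<Longrightarrow> z' \<in> Z \<Longrightarrow> (z, z') \<in> l2_rel \<Psi>"
    using in_quotient_imp_in_rel[OF equiv_l2_rel Z] by simp
  show "\<exists>z. z \<in> Z" using in_quotient_imp_non_empty[OF equiv_l2_rel Z] by (simp add: ex_in_conv)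
qed

lemma ip_L2_eq:
  assumes "Z \<in> L2 \<Psi>" "W \<in> L2 \<Psi>" "z \<in> Z" "w \<in> W"
  shows "ip_L2 \<Psi> Z W = ip_seq \<Psi> z w"
proof -
  have "ip_seq \<Psi> z' w' = ip_seq \<Psi> z w" if "z' \<in> Z" "w' \<in> W" for z' w'
    by (rule ip_seq_cong[OF L2_elems(2) L2_elems(2)]) (fact assms that)+
  then show ?thesis unfolding ip_L2_def using assms(3,4) by (intro the_equality) fast+
qed

lemma dist_L2_eq:
  assumes "Z \<in> L2 \<Psi>" "W \<in> L2 \<Psi>" "z \<in> Z" "w \<in> W"
  shows "dist_L2 \<Psi> Z W = norm_seq \<Psi> (\<lambda>k. z k - w k)"
proof -
  have "norm_seq \<Psi> (\<lambda>k. z' k - w' k) = norm_seq \<Psi> (\<lambda>k. z k - w k)" if "z' \<in> Z" "w' \<in> W" for z' w'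
  proof -
    have "(z', z) \<in> l2_rel \<Psi>" "(w', w) \<in> l2_rel \<Psi>" using that assms L2_elems(2) by blast+
    then have "((\<lambda>k. z' k - w' k), (\<lambda>k. z k - w k)) \<in> l2_rel \<Psi>"
      by (simp add: l2_rel_iff l2_diff matrix_vector_mult_diff_distrib)
    then show ?thesis unfolding norm_seq_def by (simp add: ip_seq_cong)
  qed
  then show ?thesis using assms(3,4) unfolding dist_L2_def if_P[OF conjI[OF assms(1,2)]]
    by (intro the_equality) fast+
qed

lemma Metric_space_L2: "Metric_space (L2 \<Psi>) (dist_L2 \<Psi>)"
proof
  have nn: "0 \<le> norm_seq \<Psi> z" if "z \<in> l2 \<Psi>" for z
    using that by (simp add: norm_seq_eq suminf_nonneg l2_iff psd_qf(2)[OF psd])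
  fix X Y
  show "0 \<le> dist_L2 \<Psi> X Y"
  proof (cases "X \<in> L2 \<Psi> \<and> Y \<in> L2 \<Psi>")
    case True
    then obtain x y where xy: "x \<in> X" "y \<in> Y" using L2_elems(3) by blast
    then have "x \<in> l2 \<Psi>" "y \<in> l2 \<Psi>" using True L2_elems(1) by blast+
    with True xy show ?thesis by (simp add: dist_L2_eq[OF _ _ xy] nn l2_diff)
  qed (auto simp: dist_L2_def)
  show "dist_L2 \<Psi> X Y = dist_L2 \<Psi> Y X"
  proof (cases "X \<in> L2 \<Psi> \<and> Y \<in> L2 \<Psi>")
    case True
    then obtain x y where xy: "x \<in> X" "y \<in> Y" using L2_elems(3) by blast
    then have "x \<in> l2 \<Psi>" "y \<in> l2 \<Psi>" using True L2_elems(1) by blast+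
    with True show ?thesis using norm_seq_uminus(2)[of "\<lambda>k. x k - y k"]
      by (simp add: dist_L2_eq[OF _ _ xy] dist_L2_eq[OF _ _ xy(2,1)] l2_diff)
  qed (auto simp: dist_L2_def)
next
  fix X Y assume XY: "X \<in> L2 \<Psi>" "Y \<in> L2 \<Psi>"
  then obtain x y where xy: "x \<in> X" "y \<in> Y" using L2_elems(3) by blast
  then have "x \<in> l2 \<Psi>" "y \<in> l2 \<Psi>" using XY L2_elems(1) by blast+
  then have "dist_L2 \<Psi> X Y = 0 \<longleftrightarrow> (x, y) \<in> l2_rel \<Psi>"
    using XY by (simp add: dist_L2_eq[OF _ _ xy] l2_rel_def)
  also have "\<dots> \<longleftrightarrow> X = Y"
    using quotient_eq_iff[OF equiv_l2_rel _ _ xy] XY unfolding L2_def by simp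
  finally show "dist_L2 \<Psi> X Y = 0 \<longleftrightarrow> X = Y" .
next
  fix X Y Z assume XYZ: "X \<in> L2 \<Psi>" "Y \<in> L2 \<Psi>" "Z \<in> L2 \<Psi>"
  then obtain x y z where e: "x \<in> X" "y \<in> Y" "z \<in> Z" using L2_elems(3) by metis
  then have "x \<in> l2 \<Psi>" "y \<in> l2 \<Psi>" "z \<in> l2 \<Psi>" using XYZ L2_elems(1) by blast+
  with XYZ e show "dist_L2 \<Psi> X Z \<le> dist_L2 \<Psi> X Y + dist_L2 \<Psi> Y Z"
    using norm_seq_add(2)[of "\<lambda>k. x k - y k" "\<lambda>k. y k - z k"]
    by (simp add: dist_L2_eq[of _ _ x z] dist_L2_eq[of _ _ x y] dist_L2_eq[of _ _ y z] l2_diff)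
qed

end

end

theory Submission
  imports Defs
begin

text \<open>The Lagrange identity makes \<open>\<langle>z, g\<rangle> - \<langle>f, y\<rangle>\<close> a telescoping sum, which vanishes when
  \<open>z\<close> is finitely supported with \<open>z\<^sub>0 = 0\<close>; so \<open>T\<^sub>m\<^sub>a\<^sub>x \<subseteq> T\<^sub>0\<^sup>*\<close>. Conversely, given
  \<open>{y, g} \<in> T\<^sub>0\<^sup>*\<close>, variation of constants with the fundamental matrix \<open>P\<close> yields a solution \<open>v\<close>
  of \<open>L v = \<Psi> g\<close>. For a finitely supported \<open>f\<close> the solution \<open>u\<close> of \<open>L u = \<Psi> f\<close>, \<open>u\<^sub>0 = 0\<close>, is finitely
  supported when \<open>\<Sum> P\<^sub>k\<^sup>* \<Psi>\<^sub>k f\<^sub>k = 0\<close>. Hence the functional \<open>f \<mapsto> \<langle>y - v, f\<rangle>\<close> vanishes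
  on the common kernel of the \<open>2n\<close> components of \<open>f \<mapsto> \<Sum> P\<^sub>k\<^sup>* \<Psi>\<^sub>k f\<^sub>k\<close>, so it is a
  linear combination of them. This means \<open>\<Psi> y = \<Psi> (v + P c)\<close> for a constant vector \<open>c\<close>, and
  \<open>v + P c\<close> is the required representative of \<open>y\<close>. Passing from \<open>T\<^sub>0\<close> to its closure does not change
  the adjoint because the inner product is continuous.\<close>

section \<open>Linear algebra\<close>

lemma matrix_vector_mult_uminus_right: "A *v (- x) = - (A *v x)" for x :: "complex^'a"
  by (metis diff_0 matrix_vector_mult_0_right matrix_vector_mult_diff_distrib)

lemma ctransp_mult: "ctransp (A ** B) = ctransp B ** ctransp A"
  by (simp add: ctransp_def matrix_matrix_mult_def vec_eq_iff mult.commute)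

lemma ctransp_mat_1: "ctransp (mat 1) = mat 1"
  by (auto simp: ctransp_def mat_def vec_eq_iff)

lemma Jmat_ctransp_apply: "ctransp Jmat *v x = - (Jmat *v x)"
  for x :: "complex^('n::finite + 'n)"
proof -
  have "ctransp Jmat = - (Jmat :: complex^('n + 'n)^('n::finite + 'n))"
    by (auto simp: vec_eq_iff ctransp_def Jmat_def split: sum.splits)
  then show ?thesis
    by (simp only: vec_eq_iff[of "_ *v _"]) (simp add: matrix_vector_mult_def sum_negf)
qed

lemma ctransp_Jmat_Jmat:
  "ctransp Jmat ** Jmat = (mat 1 :: complex^('n + 'n)^('n::finite + 'n))"
proof -
  have UNIV_sum: "(\<Sum>k\<in>UNIV. h k) = (\<Sum>i\<in>UNIV. h (Inl i)) + (\<Sum>i\<in>UNIV. h (Inr i))"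
    for h :: "'n::finite + 'n \<Rightarrow> complex"
    by (subst UNIV_Plus_UNIV[symmetric]) (simp add: sum.Plus del: UNIV_Plus_UNIV)
  have "(ctransp Jmat ** Jmat) $ i $ j = (mat 1 :: complex^('n + 'n)^('n + 'n)) $ i $ j"
    for i j :: "'n + 'n"
    by (cases i; cases j)
      (simp_all add: ctransp_def Jmat_def mat_def matrix_matrix_mult_def UNIV_sum
        if_distrib[of cnj] if_distrib[of "\<lambda>x. x * _"] cong: if_cong)
  then show ?thesis by (simp only: vec_eq_iff) simp
qed

lemma Jmat_Jmat_apply: "Jmat *v (Jmat *v x) = - x"
  using arg_cong[OF ctransp_Jmat_Jmat, of "\<lambda>A. A *v x"]
  by (simp add: matrix_vector_mul_assoc[symmetric] Jmat_ctransp_apply equation_minus_iff)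

lemma cdot_Jmat_Jmat: "cdot (Jmat *v x) (Jmat *v y) = cdot x y"
  by (simp add: cdot_ctransp[of _ Jmat y] Jmat_ctransp_apply Jmat_Jmat_apply)

text \<open>By hypothesis \<open>ctransp Jmat ** ctransp S ** Jmat\<close> is a left inverse of
  \<open>S\<close>, hence two-sided as \<open>S\<close> is square. So the choice in
  \<open>matrix_inv\<close> picks a genuine inverse.\<close>

lemma symplectic_matrix_inv:
  fixes S :: "complex^('n + 'n)^('n::finite + 'n)"
  assumes "ctransp S ** Jmat ** S = Jmat"
  shows "S ** matrix_inv S = mat 1"
proof -
  have "(ctransp Jmat ** ctransp S ** Jmat) ** S = mat 1"
    using assms by (metis ctransp_Jmat_Jmat matrix_mul_assoc)
  then have "\<exists>A. S ** A = mat 1 \<and> A ** S = mat 1" using matrix_left_right_inverse by blast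
  then show ?thesis unfolding matrix_inv_def by (rule someI2_ex) blast
qed

text \<open>The hypothesis makes \<open>?K ** ctransp P\<close> a left inverse of
  \<open>Jmat ** P\<close>; swapping the factors and cancelling gives
  \<open>P ** ?K ** ctransp P = ?K\<close>. This collapses the newest summand in the variation of
  constants.\<close>

lemma symplectic_ctransp:
  fixes P :: "complex^('n + 'n)^('n::finite + 'n)"
  assumes "ctransp P ** Jmat ** P = Jmat"
  shows "P *v (Jmat *v (ctransp P *v x)) = Jmat *v x"
proof -
  let ?K = "ctransp Jmat"
  have "(?K ** ctransp P) ** (Jmat ** P) = mat 1"
    using assms by (metis ctransp_Jmat_Jmat matrix_mul_assoc)
  then have "(Jmat ** P) ** (?K ** ctransp P) = mat 1"
    by (simp only: matrix_left_right_inverse)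
  then have "?K ** Jmat ** P ** ?K ** ctransp P = ?K"
    by (metis matrix_mul_assoc matrix_mul_rid)
  then have "P ** ?K ** ctransp P = ?K"
    by (simp add: ctransp_Jmat_Jmat)
  then have "P *v (?K *v (ctransp P *v x)) = ?K *v x"
    by (metis matrix_vector_mul_assoc)
  then show ?thesis
    by (simp add: Jmat_ctransp_apply matrix_vector_mult_uminus_right)
qed

text \<open>A functional that vanishes on the common kernel of others is a combination of them; \<open>G\<close> is
  the set of their joint values, so that the space on which they live need not be mentioned.\<close>

lemma functional_span:
  fixes G :: "((complex^'a) \<times> complex) set"
  assumes "finite I"
    and lin: "\<And>a s b t c. (a, s) \<in> G \<Longrightarrow> (b, t) \<in> G \<Longrightarrow> (a + c *s b, s + c * t) \<in> G"
    and ker: "\<And>a s. (a, s) \<in> G \<Longrightarrow> \<forall>i\<in>I. a $ i = 0 \<Longrightarrow> s = 0"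
  shows "\<exists>c. \<forall>(a, s)\<in>G. s = (\<Sum>i\<in>I. c i * a $ i)"
  using assms
proof (induction I arbitrary: G rule: finite_induct)
  case (insert j I)
  show ?case
  proof (cases "\<exists>(b, t)\<in>G. (\<forall>i\<in>I. b $ i = 0) \<and> b $ j \<noteq> 0")
    case True
    then obtain b t where b: "(b, t) \<in> G" "\<And>i. i \<in> I \<Longrightarrow> b $ i = 0" "b $ j \<noteq> 0" by auto
    \<comment> \<open>On \<open>b\<close> only coordinate \<open>j\<close> survives among
      \<open>insert j I\<close>, so its coefficient must be \<open>d\<close>. Once \<open>d\<close>
      times it is subtracted, the induction hypothesis applies.\<close>
    define d where "d = t / b $ j"
    define G' where "G' = (\<lambda>(a, s). (a, s - d * a $ j)) ` G"
    have "\<exists>c. \<forall>(a, s)\<in>G'. s = (\<Sum>i\<in>I. c i * a $ i)"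
    proof (rule insert.IH)
      fix a s b' t' c assume "(a, s) \<in> G'" "(b', t') \<in> G'"
      then have "(a, s + d * a $ j) \<in> G" "(b', t' + d * b' $ j) \<in> G"
        by (auto simp: G'_def)
      from insert.prems(1)[OF this, of c] show "(a + c *s b', s + c * t') \<in> G'"
        unfolding G'_def by (rule rev_image_eqI) (simp add: algebra_simps)
    next
      fix a s assume "(a, s) \<in> G'" and a: "\<forall>i\<in>I. a $ i = 0"
      then have G: "(a, s + d * a $ j) \<in> G" by (auto simp: G'_def)
      \<comment> \<open>This multiple of \<open>b\<close> cancels coordinate \<open>j\<close> and
        leaves those in \<open>I\<close> zero.\<close>
      have "s + d * a $ j + (- a $ j / b $ j) * t = 0"
        by (rule insert.prems(2)[OF insert.prems(1)[OF G b(1)]]) (use a b in auto)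
      then show "s = 0" by (simp add: d_def)
    qed
    then obtain c where c: "\<And>a s. (a, s) \<in> G' \<Longrightarrow> s = (\<Sum>i\<in>I. c i * a $ i)" by fast
    have "s = (\<Sum>i\<in>insert j I. (c(j := d)) i * a $ i)" if "(a, s) \<in> G" for a s
    proof -
      have "s - d * a $ j = (\<Sum>i\<in>I. c i * a $ i)"
        using that by (intro c) (force simp: G'_def)
      moreover have "(\<Sum>i\<in>I. (c(j := d)) i * a $ i) = (\<Sum>i\<in>I. c i * a $ i)"
        using insert.hyps by (intro sum.cong) auto
      ultimately show ?thesis using insert.hyps by (simp add: algebra_simps)
    qed
    then show ?thesis by blast
  next
    case False
    \<comment> \<open>Here vanishing on \<open>I\<close> forces vanishing at \<open>j\<close>, so
      \<open>I\<close> alone meets the kernel condition and \<open>j\<close> gets coefficient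
      0.\<close>
    have "\<exists>c. \<forall>(a, s)\<in>G. s = (\<Sum>i\<in>I. c i * a $ i)"
      by (rule insert.IH) (use insert.prems False in auto)
    then obtain c where c: "\<And>a s. (a, s) \<in> G \<Longrightarrow> s = (\<Sum>i\<in>I. c i * a $ i)" by fast
    have "s = (\<Sum>i\<in>insert j I. (c(j := 0)) i * a $ i)" if "(a, s) \<in> G" for a s
    proof -
      have "(\<Sum>i\<in>I. (c(j := 0)) i * a $ i) = (\<Sum>i\<in>I. c i * a $ i)"
        using insert.hyps by (intro sum.cong) auto
      then show ?thesis using insert.hyps c[OF that] by simp
    qed
    then show ?thesis by blast
  qed
qed auto

lemma functional_cdot:
  fixes G :: "((complex^'a) \<times> complex) set"
  assumes "\<And>a s b t c. (a, s) \<in> G \<Longrightarrow> (b, t) \<in> G \<Longrightarrow> (a + c *s b, s + c * t) \<in> G"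
    and "\<And>s. (0, s) \<in> G \<Longrightarrow> s = 0"
  obtains c where "\<And>a s. (a, s) \<in> G \<Longrightarrow> s = cdot c a"
proof -
  have "\<exists>c. \<forall>(a, s)\<in>G. s = (\<Sum>i\<in>UNIV. c i * a $ i)"
    by (rule functional_span) (use assms in \<open>auto simp: vec_eq_iff[of _ 0, symmetric, simplified]\<close>)
  then obtain c where "\<And>a s. (a, s) \<in> G \<Longrightarrow> s = (\<Sum>i\<in>UNIV. c i * a $ i)" by fast
  then show thesis by (intro that[of "\<chi> i. cnj (c i)"]) (auto simp: cdot_def)
qed

section \<open>The adjoint of a closure\<close>

context
  fixes \<Psi> :: "nat \<Rightarrow> complex^'a^'a"
  assumes psd: "\<And>k. pos_semidef (\<Psi> k)"
begin

text \<open>Cauchy-Schwarz for each \<open>\<Psi> k\<close>, then for finite sums, bounds the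
  partial sums of the absolute values; convergence and estimate follow together.\<close>

lemma ip_seq_CS:
  assumes z: "z \<in> l2 \<Psi>" and w: "w \<in> l2 \<Psi>"
  shows "summable (\<lambda>k. cdot (z k) (\<Psi> k *v w k))"
    and "cmod (ip_seq \<Psi> z w) \<le> norm_seq \<Psi> z * norm_seq \<Psi> w"
proof -
  let ?q = "\<lambda>z k. qf (\<Psi> k) (z k)" and ?t = "\<lambda>k. cmod (cdot (z k) (\<Psi> k *v w k))"
  have s: "summable (?q z)" "summable (?q w)" using assms by (simp_all add: l2_iff[OF psd])
  have nn: "0 \<le> qf (\<Psi> k) v" for k v using psd_qf(2)[OF psd] .
  have part: "sum ?t {..<n} \<le> norm_seq \<Psi> z * norm_seq \<Psi> w" for n
  proof -
    have "sum ?t {..<n} \<le> (\<Sum>k<n. \<bar>sqrt (?q z k)\<bar> * \<bar>sqrt (?q w k)\<bar>)"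
    proof (rule sum_mono)
      fix k
      have "?t k \<le> sqrt (?q z k * ?q w k)" using psd_CS[OF psd] by (rule real_le_rsqrt)
      then show "?t k \<le> \<bar>sqrt (?q z k)\<bar> * \<bar>sqrt (?q w k)\<bar>" by (simp add: real_sqrt_mult nn)
    qed
    also have "\<dots> \<le> L2_set (\<lambda>k. sqrt (?q z k)) {..<n} * L2_set (\<lambda>k. sqrt (?q w k)) {..<n}"
      by (rule L2_set_mult_ineq)
    also have "\<dots> \<le> norm_seq \<Psi> z * norm_seq \<Psi> w"
      unfolding norm_seq_eq[OF psd z] norm_seq_eq[OF psd w] L2_set_def
      by (intro mult_mono)
        (simp_all add: nn sum_nonneg suminf_nonneg s sum_le_suminf[OF s(1)] sum_le_suminf[OF s(2)])
    finally show ?thesis .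
  qed
  have sn: "summable ?t" by (rule summableI_nonneg_bounded[OF norm_ge_zero part])
  then show "summable (\<lambda>k. cdot (z k) (\<Psi> k *v w k))" by (rule summable_norm_cancel)
  show "cmod (ip_seq \<Psi> z w) \<le> norm_seq \<Psi> z * norm_seq \<Psi> w"
    unfolding ip_seq_def using summable_norm[OF sn] suminf_le_const[OF sn part] by (rule order_trans)
qed

text \<open>Lipschitz continuity in the first argument, needed to pass to the closure.\<close>

lemma ip_L2_diff_le:
  assumes "Z \<in> L2 \<Psi>" "Z' \<in> L2 \<Psi>" "g \<in> l2 \<Psi>" "G \<in> L2 \<Psi>" "g \<in> G"
  shows "cmod (ip_L2 \<Psi> Z G - ip_L2 \<Psi> Z' G) \<le> dist_L2 \<Psi> Z Z' * norm_seq \<Psi> g"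
proof -
  obtain z z' where e: "z \<in> Z" "z' \<in> Z'" using L2_elems(3)[of \<Psi>, OF psd] assms by blast
  then have l: "z \<in> l2 \<Psi>" "z' \<in> l2 \<Psi>" using L2_elems(1)[of \<Psi>, OF psd] assms by blast+
  have "ip_L2 \<Psi> Z G - ip_L2 \<Psi> Z' G = ip_seq \<Psi> (\<lambda>k. z k - z' k) g"
    using assms e suminf_diff[OF ip_seq_CS(1)[OF l(1) assms(3)] ip_seq_CS(1)[OF l(2) assms(3)]]
    by (simp add: ip_L2_eq[OF psd _ _ e(1)] ip_L2_eq[OF psd _ _ e(2)] ip_seq_def cdot_simps)
  then show ?thesis
    using ip_seq_CS(2)[OF l2_diff[OF psd l] assms(3)] assms e by (simp add: dist_L2_eq[OF psd _ _ e])
qed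

lemma adjoint_rel_closure_rel:
  assumes T: "T \<subseteq> L2 \<Psi> \<times> L2 \<Psi>"
  shows "adjoint_rel (L2 \<Psi>) (ip_L2 \<Psi>) (closure_rel (L2 \<Psi>) (dist_L2 \<Psi>) T) =
         adjoint_rel (L2 \<Psi>) (ip_L2 \<Psi>) T" (is "?A = ?B")
proof
  interpret Metric_space "L2 \<Psi>" "dist_L2 \<Psi>" by (rule Metric_space_L2[OF psd])
  have "T \<subseteq> closure_rel (L2 \<Psi>) (dist_L2 \<Psi>) T"
    unfolding closure_rel_def using T by (intro closure_of_subset) simp
  then show "?A \<subseteq> ?B" unfolding adjoint_rel_def by fast
  show "?B \<subseteq> ?A"
  proof
    fix p assume p: "p \<in> ?B"
    then obtain Y G where YG: "p = (Y, G)" "Y \<in> L2 \<Psi>" "G \<in> L2 \<Psi>"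
      and eq: "\<And>Z F. (Z, F) \<in> T \<Longrightarrow> ip_L2 \<Psi> Z G = ip_L2 \<Psi> F Y"
      unfolding adjoint_rel_def by fast
    obtain y g where yg: "y \<in> Y" "g \<in> G" using L2_elems(3)[of \<Psi>, OF psd] YG by blast
    then have l: "y \<in> l2 \<Psi>" "g \<in> l2 \<Psi>" using L2_elems(1)[of \<Psi>, OF psd] YG by blast+
    \<comment> \<open>The summand 1 keeps \<open>C\<close> positive, so that \<open>e / C\<close> is
      a legitimate radius.\<close>
    define C where "C = norm_seq \<Psi> y + norm_seq \<Psi> g + 1"
    have nn: "0 \<le> norm_seq \<Psi> y" "0 \<le> norm_seq \<Psi> g"
      using l by (simp_all add: norm_seq_eq[OF psd] suminf_nonneg l2_iff[OF psd] psd_qf(2)[OF psd])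
    have "ip_L2 \<Psi> Z G = ip_L2 \<Psi> F Y" if ZF: "(Z, F) \<in> closure_rel (L2 \<Psi>) (dist_L2 \<Psi>) T" for Z F
    proof -
      have "cmod (ip_L2 \<Psi> Z G - ip_L2 \<Psi> F Y) \<le> 0 + e" if "e > 0" for e
      proof -
        define r where "r = e / C"
        have r: "r > 0" using that nn by (simp add: r_def C_def)
        have in_L2: "Z \<in> L2 \<Psi>" "F \<in> L2 \<Psi>"
          using ZF unfolding closure_rel_def in_closure_of by auto
        have "openin (prod_topology mtopology mtopology) (mball Z r \<times> mball F r)"
          by (simp add: openin_prod_Times_iff)
        moreover have "(Z, F) \<in> mball Z r \<times> mball F r" using in_L2 r by simp
        moreover have "\<And>U. (Z, F) \<in> U \<Longrightarrow> openin (prod_topology mtopology mtopology) U \<Longrightarrow>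
            \<exists>q. q \<in> T \<and> q \<in> U"
          using ZF unfolding closure_rel_def in_closure_of by (elim conjE) (simp only: simp_thms)
        ultimately have "\<exists>q. q \<in> T \<and> q \<in> mball Z r \<times> mball F r" by (simp only:)
        then obtain Z' F' where T': "(Z', F') \<in> T" and "Z' \<in> mball Z r" "F' \<in> mball F r"
          by auto
        then have L': "Z' \<in> L2 \<Psi>" "F' \<in> L2 \<Psi>" and d: "dist_L2 \<Psi> Z Z' < r" "dist_L2 \<Psi> F F' < r"
          by auto
        \<comment> \<open>The terms at \<open>Z'\<close> and \<open>F'\<close> cancel, since the
          adjoint equation holds on \<open>T\<close>.\<close>
        have "cmod (ip_L2 \<Psi> Z G - ip_L2 \<Psi> F Y) \<le>
            cmod (ip_L2 \<Psi> Z G - ip_L2 \<Psi> Z' G) + cmod (ip_L2 \<Psi> F Y - ip_L2 \<Psi> F' Y)"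
          using eq[OF T'] norm_triangle_ineq4[of "ip_L2 \<Psi> Z G - ip_L2 \<Psi> Z' G" "ip_L2 \<Psi> F Y - ip_L2 \<Psi> F' Y"]
          by simp
        also have "\<dots> \<le> dist_L2 \<Psi> Z Z' * norm_seq \<Psi> g + dist_L2 \<Psi> F F' * norm_seq \<Psi> y"
          using in_L2 L' YG yg l by (intro add_mono ip_L2_diff_le)
        also have "\<dots> \<le> r * norm_seq \<Psi> g + r * norm_seq \<Psi> y"
          using d nn by (intro add_mono mult_right_mono) auto
        also have "\<dots> \<le> r * C" using r by (simp add: C_def algebra_simps)
        also have "\<dots> = e" using nn by (simp add: r_def C_def)
        finally show ?thesis by simp
      qed
      then have "cmod (ip_L2 \<Psi> Z G - ip_L2 \<Psi> F Y) \<le> 0" by (rule field_le_epsilon)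
      then show ?thesis by simp
    qed
    then show "p \<in> ?A" using YG unfolding adjoint_rel_def by auto
  qed
qed

end

section \<open>Solutions of the system\<close>

text \<open>For invertible \<open>S k\<close> this is the fundamental matrix of
  \<open>Lop S z = 0\<close>, normalised at 0.\<close>

primrec fund :: "(nat \<Rightarrow> complex^'a^'a) \<Rightarrow> nat \<Rightarrow> complex^'a^'a" where
  "fund S 0 = mat 1"
| "fund S (Suc k) = matrix_inv (S k) ** fund S k"

text \<open>Variation of constants; the inverse of a symplectic matrix \<open>P\<close> is \<open>- J P\<^sup>* J\<close>.\<close>

definition var_const :: "(nat \<Rightarrow> complex^('n + 'n)^('n + 'n)) \<Rightarrow>
    (nat \<Rightarrow> complex^('n + 'n)^('n::finite + 'n)) \<Rightarrow> ('n + 'n) cseq \<Rightarrow> ('n + 'n) cseq" where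
  "var_const S \<Psi> f k =
     fund S k *v (Jmat *v (\<Sum>j<k. ctransp (fund S j) *v (\<Psi> j *v f j)))"

context
  fixes S \<Psi> :: "nat \<Rightarrow> complex^('n::finite + 'n)^('n + 'n)"
  assumes sympl: "\<And>k. ctransp (S k) ** Jmat ** S k = Jmat"
    and psd: "\<And>k. pos_semidef (\<Psi> k)"
    and nil: "\<And>k. \<Psi> k ** Jmat ** \<Psi> k = 0"
begin

section \<open>Fundamental matrix, Lagrange identity and Green's formula\<close>

lemma herm: "ctransp (\<Psi> k) = \<Psi> k"
  using psd by (simp add: pos_semidef_def)

lemma fund_step: "S k ** fund S (Suc k) = fund S k"
  by (simp add: matrix_mul_assoc symplectic_matrix_inv[OF sympl])

lemma fund_symplectic: "ctransp (fund S k) ** Jmat ** fund S k = Jmat"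
proof (induction k)
  case (Suc k)
  \<comment> \<open>Reading the recursion backwards, with \<open>R\<close> the next fundamental
    matrix, avoids computing with inverses.\<close>
  have "ctransp (S k ** R) ** Jmat ** (S k ** R) = ctransp R ** (ctransp (S k) ** Jmat ** S k) ** R"
    for R by (simp add: ctransp_mult matrix_mul_assoc)
  from this[of "fund S (Suc k)"] Suc show ?case by (simp only: fund_step sympl)
qed (simp add: ctransp_mat_1)

lemma Lop_fund: "Lop S (\<lambda>k. fund S k *v c) k = 0"
  using fund_step[of k] unfolding Lop_def
  by (simp add: matrix_vector_mul_assoc del: fund.simps)

lemma Lop_add: "Lop S (\<lambda>k. z k + w k) k = Lop S z k + Lop S w k"
  by (simp add: Lop_def matrix_vector_right_distrib matrix_vector_mult_diff_distrib)

lemma Lop_var_const: "Lop S (var_const S \<Psi> f) k = \<Psi> k *v f k"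
proof -
  let ?P = "fund S" and ?a = "\<lambda>j. ctransp (fund S j) *v (\<Psi> j *v f j)"
  have "S k *v var_const S \<Psi> f (Suc k) = ?P k *v (Jmat *v (\<Sum>j<Suc k. ?a j))"
    unfolding var_const_def by (simp only: matrix_vector_mul_assoc matrix_mul_assoc fund_step)
  also have "\<dots> = var_const S \<Psi> f k + Jmat *v (\<Psi> k *v f k)"
    by (simp add: var_const_def matrix_vector_right_distrib symplectic_ctransp[OF fund_symplectic])
  finally show ?thesis
    by (simp add: Lop_def matrix_vector_mult_uminus_right Jmat_Jmat_apply)
qed

text \<open>Solve both equations for the values at \<open>k\<close> and expand the form given by
  \<open>Jmat\<close>. The \<open>S k\<close> parts give its value at \<open>Suc k\<close>, the
  mixed terms give the left side, and the product of the two inhomogeneities vanishes by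
  \<open>nil\<close>.\<close>

lemma Lagrange_identity:
  assumes z: "Lop S z k = \<Psi> k *v f k" and w: "Lop S w k = \<Psi> k *v g k"
  shows "cdot (z k) (\<Psi> k *v g k) - cdot (f k) (\<Psi> k *v w k) =
    cdot (z k) (Jmat *v w k) - cdot (z (Suc k)) (Jmat *v w (Suc k))"
proof -
  define a b where "a = \<Psi> k *v f k" and "b = \<Psi> k *v g k"
  have step: "u k = S k *v u (Suc k) - Jmat *v x" if "Lop S u k = x" for u x
    using that[symmetric] by (simp add: Lop_def Jmat_Jmat_apply)
  have za: "z k = S k *v z (Suc k) - Jmat *v a" and wb: "w k = S k *v w (Suc k) - Jmat *v b"
    unfolding a_def b_def by (rule step[OF z], rule step[OF w])
  have "cdot (S k *v z (Suc k)) (Jmat *v (S k *v w (Suc k))) =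
      cdot (z (Suc k)) (ctransp (S k) ** Jmat ** S k *v w (Suc k))"
    unfolding matrix_vector_mul_assoc[symmetric] cdot_ctransp[of "z (Suc k)" "ctransp (S k)"]
    by (simp add: ctransp_def)
  also have "\<dots> = cdot (z (Suc k)) (Jmat *v w (Suc k))" by (simp add: sympl)
  finally have S: "cdot (S k *v z (Suc k)) (Jmat *v (S k *v w (Suc k))) =
      cdot (z (Suc k)) (Jmat *v w (Suc k))" .
  have Jw: "Jmat *v w k = Jmat *v (S k *v w (Suc k)) + b"
    by (simp add: wb matrix_vector_mult_diff_distrib Jmat_Jmat_apply)
  have "cdot a (Jmat *v b) = cdot (f k) (\<Psi> k ** Jmat ** \<Psi> k *v g k)"
    unfolding a_def b_def matrix_vector_mul_assoc[symmetric]
    by (simp add: cdot_ctransp[of "f k" "\<Psi> k"] herm)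
  then have ab: "cdot a (Jmat *v b) = 0" by (simp add: nil cdot_simps)
  have "cdot (z k) (Jmat *v w k) = cdot (z k) b + cdot (z k) (Jmat *v (S k *v w (Suc k)))"
    by (simp add: Jw cdot_simps)
  also have "cdot (z k) (Jmat *v (S k *v w (Suc k))) =
      cdot (z (Suc k)) (Jmat *v w (Suc k)) - cdot a (S k *v w (Suc k))"
    by (subst za) (simp add: cdot_simps S cdot_Jmat_Jmat)
  also have "cdot a (S k *v w (Suc k)) = cdot a (w k)"
    by (simp add: wb cdot_simps ab)
  also have "cdot a (w k) = cdot (f k) (\<Psi> k *v w k)"
    by (simp add: a_def cdot_ctransp[of "f k" "\<Psi> k"] herm)
  finally show ?thesis by (simp add: b_def)
qed

text \<open>The telescoped sum leaves boundary terms at 0 and at \<open>N\<close>, where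
  \<open>u\<close> vanishes. The solution \<open>w\<close> may lie outside \<open>l2 \<Psi>\<close>,
  so \<open>var_const\<close> is admissible.\<close>

lemma Green_formula:
  assumes u: "u \<in> l2_0" and "\<And>k. Lop S u k = \<Psi> k *v f k" and "\<And>k. Lop S w k = \<Psi> k *v g k"
  shows "ip_seq \<Psi> u g = ip_seq \<Psi> f w"
proof -
  from u obtain N where N: "\<And>k. k \<ge> N \<Longrightarrow> u k = 0"
    using finite_nat_bounded[of "{k. u k \<noteq> 0}"] unfolding l2_0_def
    by (metis (mono_tags, lifting) lessThan_iff mem_Collect_eq not_le subsetD)
  \<comment> \<open>\<open>f\<close> itself may have infinite support, but \<open>Lop S u k\<close>
    involves only \<open>u k\<close> and \<open>u (Suc k)\<close>.\<close>
  have "\<Psi> k *v f k = 0" if "k \<ge> N" for k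
    using that N[of k] N[of "Suc k"] by (simp add: assms(2)[symmetric] Lop_def)
  then have f0: "cdot (f k) (\<Psi> k *v w k) = 0" if "k \<ge> N" for k
    using that by (simp add: cdot_ctransp[of "f k" "\<Psi> k"] herm cdot_simps)
  have "ip_seq \<Psi> u g = (\<Sum>k<N. cdot (u k) (\<Psi> k *v g k))"
    unfolding ip_seq_def by (rule suminf_finite) (simp_all add: N cdot_simps)
  moreover have "ip_seq \<Psi> f w = (\<Sum>k<N. cdot (f k) (\<Psi> k *v w k))"
    unfolding ip_seq_def by (rule suminf_finite) (simp_all add: f0)
  moreover have "(\<Sum>k<N. cdot (u k) (\<Psi> k *v g k) - cdot (f k) (\<Psi> k *v w k)) = 0"
    unfolding Lagrange_identity[of u _ f w g, OF assms(2,3)]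
      sum_lessThan_telescope'[of "\<lambda>k. cdot (u k) (Jmat *v w k)"]
    using u by (simp add: N cdot_simps l2_0_def)
  ultimately show ?thesis by (simp add: sum_subtractf)
qed

lemma finite_support_l2: "(\<And>k. k \<ge> N \<Longrightarrow> z k = 0) \<Longrightarrow> z \<in> l2 \<Psi>"
  unfolding l2_def mem_Collect_eq by (rule summable_finite[of "{..<N}"]) (simp_all add: cdot_simps)

section \<open>The two inclusions between the adjoint of \<open>T_0\<close> and
  \<open>T_max\<close>\<close>

lemma adjoint_T_0_subset: "adjoint_rel (L2 \<Psi>) (ip_L2 \<Psi>) (T_0 S \<Psi>) \<subseteq> T_max S \<Psi>"
proof
  note equiv = equiv_l2_rel[of \<Psi>, OF psd]
  fix p assume "p \<in> adjoint_rel (L2 \<Psi>) (ip_L2 \<Psi>) (T_0 S \<Psi>)"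
  then obtain Y G where p: "p = (Y, G)" and YG: "Y \<in> L2 \<Psi>" "G \<in> L2 \<Psi>"
    and adj: "\<And>Z F. (Z, F) \<in> T_0 S \<Psi> \<Longrightarrow> ip_L2 \<Psi> Z G = ip_L2 \<Psi> F Y"
    unfolding adjoint_rel_def by fast
  obtain y g where yg: "y \<in> Y" "g \<in> G" using L2_elems(3)[of \<Psi>, OF psd] YG by blast
  then have l: "y \<in> l2 \<Psi>" "g \<in> l2 \<Psi>" using L2_elems(1)[of \<Psi>, OF psd] YG by blast+
  define v where "v = var_const S \<Psi> g"
  define a where "a N f = (\<Sum>k<N. ctransp (fund S k) *v (\<Psi> k *v f k))" for N f
  define t where "t N f = (\<Sum>k<N. cdot (y k - v k) (\<Psi> k *v f k))" for N f
  define D where "D = {(a N f, t N f) | N f. \<forall>k\<ge>N. f k = 0}"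
  have orth: "t N f = 0" if f: "\<forall>k\<ge>N. f k = 0" and "a N f = 0" for N f
  proof -
    \<comment> \<open>\<open>u 0\<close> is zero because the sum is empty, and from \<open>N\<close>
      on the sum equals \<open>a N f = 0\<close>.\<close>
    define u where "u = var_const S \<Psi> f"
    have "(\<Sum>k<m. ctransp (fund S k) *v (\<Psi> k *v f k)) = a N f" if "m \<ge> N" for m
      unfolding a_def using f that by (intro sum.mono_neutral_right) auto
    then have u0: "u m = 0" if "m \<ge> N" for m
      using that \<open>a N f = 0\<close> by (simp add: u_def var_const_def)
    have "{k. u k \<noteq> 0} \<subseteq> {..<N}" by (auto simp: u0 simp flip: not_le)
    then have "finite {k. u k \<noteq> 0}" by (rule finite_subset) simp
    then have u: "u \<in> l2_0" by (simp add: l2_0_def) (simp add: u_def var_const_def)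
    have lu: "u \<in> l2 \<Psi>" "f \<in> l2 \<Psi>"
      by (rule finite_support_l2[of N], use u0 f in simp)+
    let ?U = "l2_rel \<Psi> `` {u}" and ?F = "l2_rel \<Psi> `` {f}"
    have mem: "?U \<in> L2 \<Psi>" "?F \<in> L2 \<Psi>" unfolding L2_def by (intro quotientI lu)+
    have self: "u \<in> ?U" "f \<in> ?F" by (intro equiv_class_self[OF equiv] lu)+
    have "(?U, ?F) \<in> T_0 S \<Psi>"
      unfolding T_0_def using mem self u Lop_var_const[of f, folded u_def] by blast
    then have "ip_seq \<Psi> u g = ip_seq \<Psi> f y"
      using adj ip_L2_eq[of \<Psi>, OF psd mem(1) YG(2) self(1) yg(2)]
        ip_L2_eq[of \<Psi>, OF psd mem(2) YG(1) self(2) yg(1)] by simp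
    \<comment> \<open>Compared with the adjoint equation, this makes \<open>f\<close> orthogonal to
      \<open>y - v\<close>.\<close>
    moreover have "ip_seq \<Psi> u g = ip_seq \<Psi> f v"
      using u by (rule Green_formula) (simp_all add: u_def v_def Lop_var_const)
    moreover have "ip_seq \<Psi> f w = (\<Sum>k<N. cdot (f k) (\<Psi> k *v w k))" for w
      unfolding ip_seq_def by (rule suminf_finite) (use f in \<open>simp_all add: cdot_simps\<close>)
    ultimately have "(\<Sum>k<N. cdot (f k) (\<Psi> k *v (y k - v k))) = 0"
      by (simp add: matrix_vector_mult_diff_distrib cdot_simps sum_subtractf)
    then have "cnj (t N f) = 0"
      unfolding t_def by (simp add: herm_cnj[OF herm, of "_ - _"])
    then show ?thesis by simp
  qed
  have extend: "a M f = a N f" "t M f = t N f" if "\<forall>k\<ge>N. f k = 0" "N \<le> M" for N M f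
    unfolding a_def t_def using that
    by (auto intro!: sum.mono_neutral_right simp: cdot_simps simp flip: not_le)
  obtain c where c: "\<And>x s. (x, s) \<in> D \<Longrightarrow> s = cdot c x"
  proof (rule functional_cdot)
    fix x s x' s' c assume "(x, s) \<in> D" "(x', s') \<in> D"
    then obtain N f N' f' where f: "\<forall>k\<ge>N. f k = 0" "x = a N f" "s = t N f"
      and f': "\<forall>k\<ge>N'. f' k = 0" "x' = a N' f'" "s' = t N' f'" unfolding D_def by blast
    define M where "M = max N N'"
    have M: "x = a M f" "x' = a M f'" "s = t M f" "s' = t M f'"
      using extend[OF f(1), of M] extend[OF f'(1), of M] f f' by (simp_all add: M_def)
    have "x + c *s x' = a M (\<lambda>k. f k + c *s f' k)"
      by (simp add: M a_def matrix_vector_right_distrib vector_scalar_commute sum.distrib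
          vec.scale_sum_right)
    moreover have "s + c * s' = t M (\<lambda>k. f k + c *s f' k)"
      by (simp add: M t_def matrix_vector_right_distrib vector_scalar_commute sum.distrib
          cdot_simps(3,6) sum_distrib_left)
    moreover have "\<forall>k\<ge>M. f k + c *s f' k = 0" using f f' by (simp add: M_def)
    ultimately show "(x + c *s x', s + c * s') \<in> D" unfolding D_def by blast
  next
    fix s assume "(0, s) \<in> D"
    then show "s = 0" unfolding D_def using orth by auto
  qed blast
  define u where "u k = v k + fund S k *v c" for k
  have same: "\<Psi> k *v y k = \<Psi> k *v u k" for k
  proof -
    define e where "e = y k - u k"
    \<comment> \<open>Testing with the defect \<open>e\<close> concentrated at \<open>k\<close>
      yields its own quadratic form, whose vanishing gives \<open>\<Psi> k *v e = 0\<close>.\<close>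
    let ?f = "\<lambda>j. if j = k then e else 0"
    have "(a (Suc k) ?f, t (Suc k) ?f) \<in> D" unfolding D_def by force
    moreover have "a (Suc k) ?f = ctransp (fund S k) *v (\<Psi> k *v e)"
      by (simp add: a_def)
    moreover have "t (Suc k) ?f = cdot (y k - v k) (\<Psi> k *v e)"
      by (simp add: t_def cdot_simps)
    ultimately have "cdot (y k - v k) (\<Psi> k *v e) = cdot c (ctransp (fund S k) *v (\<Psi> k *v e))"
      using c by metis
    also have "\<dots> = cdot (fund S k *v c) (\<Psi> k *v e)"
      by (simp add: cdot_ctransp[of c] ctransp_def)
    finally have "cdot e (\<Psi> k *v e) = 0"
      unfolding e_def u_def by (simp add: cdot_simps diff_eq_eq add.commute)
    then have "\<Psi> k *v e = 0" by (intro psd_kernel[OF psd]) simp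
    then show ?thesis by (simp add: e_def matrix_vector_mult_diff_distrib)
  qed
  \<comment> \<open>Square summability of \<open>u\<close> is inherited from \<open>y\<close>, not
    from \<open>v\<close> and the homogeneous solution separately.\<close>
  have "cdot (u k) (\<Psi> k *v u k) = cdot (y k) (\<Psi> k *v y k)" for k
    using cdot_ctransp[of _ "\<Psi> k"] same[of k] by (simp add: herm)
  then have "u \<in> l2 \<Psi>" using l(1) by (simp add: l2_def)
  then have "(y, u) \<in> l2_rel \<Psi>" using l(1) same by (simp add: l2_rel_iff[OF psd])
  then have "u \<in> Y" using YG(1) yg(1) unfolding L2_def
    using in_quotient_imp_closed[OF equiv] by fast
  moreover have "Lop S u k = \<Psi> k *v g k" for k
    unfolding u_def by (simp add: Lop_add Lop_fund v_def Lop_var_const)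
  ultimately show "p \<in> T_max S \<Psi>" unfolding p T_max_def using YG yg by auto
qed

lemma T_max_subset_adjoint: "T_max S \<Psi> \<subseteq> adjoint_rel (L2 \<Psi>) (ip_L2 \<Psi>) (T_0 S \<Psi>)"
proof
  fix p assume "p \<in> T_max S \<Psi>"
  then obtain Y G w g where p: "p = (Y, G)" "Y \<in> L2 \<Psi>" "G \<in> L2 \<Psi>" "w \<in> Y" "g \<in> G"
    and w: "\<forall>k. Lop S w k = \<Psi> k *v g k" by (auto simp: T_max_def)
  have "ip_L2 \<Psi> Z G = ip_L2 \<Psi> F Y" if "(Z, F) \<in> T_0 S \<Psi>" for Z F
  proof -
    from that obtain u f where ZF: "Z \<in> L2 \<Psi>" "F \<in> L2 \<Psi>" "u \<in> Z" "f \<in> F" and u: "u \<in> l2_0"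
      and Lu: "\<forall>k. Lop S u k = \<Psi> k *v f k" by (auto simp: T_0_def)
    have "ip_seq \<Psi> u g = ip_seq \<Psi> f w"
      using u by (rule Green_formula) (simp_all add: Lu w)
    then show ?thesis
      by (simp only: ip_L2_eq[of \<Psi>, OF psd ZF(1) p(3) ZF(3) p(5)]
          ip_L2_eq[of \<Psi>, OF psd ZF(2) p(2) ZF(4) p(4)])
  qed
  then show "p \<in> adjoint_rel (L2 \<Psi>) (ip_L2 \<Psi>) (T_0 S \<Psi>)"
    using p unfolding adjoint_rel_def by auto
qed

end

theorem theorem5p10:
  fixes S \<Psi> :: "nat \<Rightarrow> complex^('n::finite + 'n)^('n + 'n)"
  assumes "\<And>k. ctransp (S k) ** Jmat ** S k = Jmat"
    and "\<And>k. pos_semidef (\<Psi> k)"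
    and "\<And>k. \<Psi> k ** Jmat ** \<Psi> k = 0"
  shows "adjoint_rel (L2 \<Psi>) (ip_L2 \<Psi>) (T_0 S \<Psi>) = T_max S \<Psi> \<and>
         adjoint_rel (L2 \<Psi>) (ip_L2 \<Psi>) (T_min S \<Psi>) = T_max S \<Psi>"
proof -
  have "adjoint_rel (L2 \<Psi>) (ip_L2 \<Psi>) (T_0 S \<Psi>) = T_max S \<Psi>"
    using adjoint_T_0_subset[OF assms] T_max_subset_adjoint[OF assms] by (rule equalityI)
  moreover have "T_0 S \<Psi> \<subseteq> L2 \<Psi> \<times> L2 \<Psi>" by (auto simp: T_0_def)
  ultimately show ?thesis
    unfolding T_min_def by (simp add: adjoint_rel_closure_rel[OF assms(2)])
qed

end
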